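(* Let $q$ be a prime power, $n$ a positive integer, and let $f\in\mathcal{L}_{n,q}$ with $f\notin\langle x\rangle_{\mathbb{F}_{q^n}}$. Let $\mathcal{C}_f=\langle x,f\rangle_{\mathbb{F}_{q^n}}\subseteq\mathcal{L}_{n,q}$ be the associated rank-metric code. Then the $\mathbb{F}_q$-algebras $\mathbb{S}_f$ and $R(\mathcal{C}_f)$ are isomorphic.
   Context: $\mathcal{L}_{n,q}$ is the $\mathbb{F}_q$-algebra (with sum, composition $\circ$, and multiplication by scalars in $\mathbb{F}_q$) of $q$-polynomials over $\mathbb{F}_{q^n}$ modulo $x^{q^n}-x$, i.e. polynomials $\sum_{i=0}^{n-1}a_ix^{q^i}$ with $a_i\in\mathbb{F}_{q^n}$, identified with the $\mathbb{F}_q$-linear endomorphisms of $\mathbb{F}_{q^n}$. $\langle x\rangle_{\mathbb{F}_{q^n}}=\{ax : a\in\mathbb{F}_{q^n}\}$ and $\langle x,f\rangle_{\mathbb{F}_{q^n}}=\{ax+bf : a,b\in\mathbb{F}_{q^n}\}$. The graph of $f$ is $\mathcal{G}_f=\{(y,f(y)) : y\in\mathbb{F}_{q^n}\}$, and $\mathbb{S}_f=\{A\in\mathbb{F}_{q^n}^{2\times2} : A\mathcal{G}_f\subseteq\mathcal{G}_f\}$ with $A\mathcal{G}_f=\left\{A\begin{pmatrix}y\\ f(y)\end{pmatrix} : y\in\mathbb{F}_{q^n}\right\}$; it is an $\mathbb{F}_q$-algebra under matrix sum, matrix product and multiplication by scalars in $\mathbb{F}_q$. The right idealizer of an $\mathbb{F}_q$-subspace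 $\mathcal{C}\subseteq\mathcal{L}_{n,q}$ is $R(\mathcal{C})=\{g\in\mathcal{L}_{n,q} : h\circ g\in\mathcal{C}\text{ for all }h\in\mathcal{C}\}$, an $\mathbb{F}_q$-algebra under sum, composition and multiplication by scalars in $\mathbb{F}_q$. *)

theory Defs
  imports
    "HOL-Analysis.Analysis"
    "HOL-Algebra.QuotRing"
    "HOL-Algebra.Module"
    "HOL-Computational_Algebra.Polynomial"
    "HOL-Number_Theory.Prime_Powers"
begin

text \<open>
  The field with \<open>q\<^sup>n\<close> elements is a type \<open>'a\<close> of class \<open>finite_field\<close> with \<open>CARD('a) = q ^ n\<close>.
  Its subfield with \<open>q\<close> elements is the fixed field of \<open>c \<mapsto> c\<^sup>q\<close>.
\<close>

definition Fq :: "nat \<Rightarrow> 'a::finite_field set" where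
  "Fq q = {c. c ^ q = c}"

definition qpolys :: "nat \<Rightarrow> nat \<Rightarrow> 'a::finite_field poly set" where
  "qpolys q n = {\<Sum>i<n. monom (a i) (q ^ i) | a. True}"

definition qcomp :: "nat \<Rightarrow> nat \<Rightarrow> 'a::finite_field poly \<Rightarrow> 'a poly \<Rightarrow> 'a poly" where
  "qcomp q n h g = pcompose h g mod (monom 1 (q ^ n) - monom 1 1)"

definition span_x :: "'a::finite_field poly set" where
  "span_x = {Polynomial.smult a (monom 1 1) | a. True}"

definition code :: "'a::finite_field poly \<Rightarrow> 'a poly set" where
  "code f = {Polynomial.smult a (monom 1 1) + Polynomial.smult b f | a b. True}"

definition graph :: "'a::finite_field poly \<Rightarrow> ('a ^ 2) set" where
  "graph f = {vector [y, poly f y] | y. True}"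

definition stabilizer :: "'a::finite_field poly \<Rightarrow> ('a ^ 2 ^ 2) set" where
  "stabilizer f = {A. (\<lambda>v. A *v v) ` graph f \<subseteq> graph f}"

definition right_idealizer :: "nat \<Rightarrow> nat \<Rightarrow> 'a::finite_field poly set \<Rightarrow> 'a poly set" where
  "right_idealizer q n C = {g \<in> qpolys q n. \<forall>h\<in>C. qcomp q n h g \<in> C}"

definition stabilizer_algebra ::
    "'a::finite_field poly \<Rightarrow> ('a, 'a ^ 2 ^ 2) module" where
  "stabilizer_algebra f =
    \<lparr>carrier = stabilizer f, mult = (**), one = mat 1, zero = 0, add = (+),
     smult = (\<lambda>c. map_matrix ((*) c))\<rparr>"

definition right_idealizer_algebra ::
    "nat \<Rightarrow> nat \<Rightarrow> 'a::finite_field poly set \<Rightarrow> ('a, 'a poly) module" where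
  "right_idealizer_algebra q n C =
    \<lparr>carrier = right_idealizer q n C, mult = qcomp q n, one = monom 1 1, zero = 0, add = (+),
     smult = Polynomial.smult\<rparr>"

text \<open>
  Isomorphism of associative unital algebras over a set \<open>K\<close> of scalars. The locale \<open>algebra\<close>
  is not applicable here since it is restricted to commutative algebras.
\<close>

definition algebra_isomorphic ::
    "'k set \<Rightarrow> ('k, 'a, 'm) module_scheme \<Rightarrow> ('k, 'b, 'n) module_scheme \<Rightarrow> bool" where
  "algebra_isomorphic K A B \<longleftrightarrow>
    (\<exists>\<phi> \<in> ring_iso A B. \<forall>c\<in>K. \<forall>x\<in>carrier A. \<phi> (c \<odot>\<^bsub>A\<^esub> x) = c \<odot>\<^bsub>B\<^esub> \<phi> x)"

end

theory Submission
  imports Defs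
begin

text \<open>
  A matrix \<open>A\<close> with rows \<open>(a, b)\<close> and \<open>(c, d)\<close> stabilizes the graph of \<open>f\<close> iff
  \<open>f \<circ> g = c x + d f\<close> for \<open>g = a x + b f\<close>, that is, iff \<open>A (x, f)\<^sup>T = (x, f)\<^sup>T \<circ> g\<close>.
  Hence \<open>A \<mapsto> g\<close> is multiplicative with values in the right idealizer, and since \<open>x\<close> and \<open>f\<close> are
  linearly independent, \<open>A\<close> is recovered from the coordinates of \<open>g = x \<circ> g\<close> and \<open>f \<circ> g\<close>.
  Identities between reduced polynomials, which have degree below \<open>q\<^sup>n\<close>, are checked pointwise.
\<close>

text \<open>Otherwise the nonzero difference would have more roots than its degree allows.\<close>

lemma poly_eq_if_eval_eq:
  fixes p r :: "'a::finite_field poly"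
  assumes "degree p < CARD('a)" "degree r < CARD('a)" "\<And>y. poly p y = poly r y"
  shows "p = r"
  using assms by (intro poly_eqI_degree[of UNIV]) auto

text \<open>Every field element is a root of the modulus, so reduction leaves the induced function
  unchanged.\<close>

lemma poly_mod_X_pow_CARD:
  fixes p :: "'a::finite_field poly"
  assumes "CARD('a) = q ^ n"
  shows "poly (p mod (monom 1 (q ^ n) - monom 1 1)) y = poly p y"
proof -
  let ?m = "monom 1 (q ^ n) - monom 1 1 :: 'a poly"
  have "y ^ (q ^ n) = y"
    using finite_field_power_card_eq_same[of y] assms by simp
  then have "poly ?m y = 0"
    by (simp add: poly_monom)
  moreover have "poly p y = poly (p div ?m) y * poly ?m y + poly (p mod ?m) y"
    by (metis div_mult_mod_eq poly_add poly_mult)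
  ultimately show ?thesis
    by simp
qed

lemma degree_mod_X_pow_CARD_less:
  fixes p :: "'a::finite_field poly"
  assumes "CARD('a) = q ^ n"
  shows "degree (p mod (monom 1 (q ^ n) - monom 1 1)) < CARD('a)"
proof -
  let ?m = "monom 1 (q ^ n) - monom 1 1 :: 'a poly"
  \<comment> \<open>Since \<open>0\<close> and \<open>1\<close> differ, \<open>q ^ n\<close> exceeds
    1 and the two monomials of the modulus do not cancel.\<close>
  have "card {0, 1 :: 'a} \<le> CARD('a)"
    by (intro card_mono) auto
  then have *: "1 < CARD('a)"
    by simp
  have "coeff ?m (q ^ n) = 1"
    using * assms by simp
  then have "?m \<noteq> 0"
    by (metis coeff_0 zero_neq_one)
  moreover have "degree ?m \<le> CARD('a)"
    using * assms
    by (intro degree_diff_le) (auto intro: order_trans[OF degree_monom_le])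
  ultimately show ?thesis
    using * degree_mod_less[of ?m p] by auto
qed

lemma poly_qcomp:
  fixes h g :: "'a::finite_field poly"
  assumes "CARD('a) = q ^ n"
  shows "poly (qcomp q n h g) y = poly h (poly g y)"
  unfolding qcomp_def poly_mod_X_pow_CARD[OF assms] by (rule poly_pcompose)

lemma degree_qcomp_less:
  fixes h g :: "'a::finite_field poly"
  assumes "CARD('a) = q ^ n"
  shows "degree (qcomp q n h g) < CARD('a)"
  unfolding qcomp_def by (rule degree_mod_X_pow_CARD_less[OF assms])

lemma degree_qpolys_less:
  fixes p :: "'a::finite_field poly"
  assumes "CARD('a) = q ^ n" "2 \<le> q" "p \<in> qpolys q n"
  shows "degree p < CARD('a)"
proof -
  obtain a where p: "p = (\<Sum>i<n. monom (a i) (q ^ i))"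
    using assms(3) by (auto simp: qpolys_def)
  have "degree (monom (a i) (q ^ i)) < q ^ n" if "i < n" for i
    using that assms(2) by (intro le_less_trans[OF degree_monom_le] power_strict_increasing) auto
  then show ?thesis
    unfolding p assms(1) using assms(2) by (intro degree_sum_less) auto
qed

lemma sum_monom_in_qpolys: "(\<Sum>i<n. monom (a i) (q ^ i)) \<in> qpolys q n"
  unfolding qpolys_def by blast

lemma qpolys_add:
  assumes "p \<in> qpolys q n" "r \<in> qpolys q n"
  shows "p + r \<in> qpolys q n"
proof -
  obtain a b where "p = (\<Sum>i<n. monom (a i) (q ^ i))" "r = (\<Sum>i<n. monom (b i) (q ^ i))"
    using assms by (auto simp: qpolys_def)
  then have "p + r = (\<Sum>i<n. monom (a i + b i) (q ^ i))"
    by (simp add: add_monom flip: sum.distrib)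
  then show ?thesis
    by (simp only: sum_monom_in_qpolys)
qed

lemma qpolys_smult:
  assumes "p \<in> qpolys q n"
  shows "Polynomial.smult c p \<in> qpolys q n"
proof -
  obtain a where "p = (\<Sum>i<n. monom (a i) (q ^ i))"
    using assms by (auto simp: qpolys_def)
  then have "Polynomial.smult c p = (\<Sum>i<n. monom (c * a i) (q ^ i))"
    by (simp add: poly_eq_iff coeff_sum sum_distrib_left if_distrib cong: if_cong)
  then show ?thesis
    by (simp only: sum_monom_in_qpolys)
qed

lemma X_in_qpolys:
  assumes "n > 0"
  shows "monom 1 1 \<in> qpolys q n"
proof -
  have "(\<Sum>i<n. monom (if i = 0 then 1 else 0) (q ^ i)) =
      (\<Sum>i<n. if i = 0 then monom 1 1 else (0 :: 'a poly))"
    by (intro sum.cong) auto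
  also have "\<dots> = monom 1 1"
    using assms by simp
  finally show ?thesis
    using sum_monom_in_qpolys[where a = "\<lambda>i. if i = 0 then 1 else 0"] by metis
qed

text \<open>A graph point is determined by its first coordinate, so only the second coordinate of
  the image has to be compared.\<close>

lemma mem_stabilizer_iff:
  "A \<in> stabilizer f \<longleftrightarrow>
    (\<forall>y. poly f (A$1$1 * y + A$1$2 * poly f y) = A$2$1 * y + A$2$2 * poly f y)"
proof -
  have "A *v vector [y, poly f y] \<in> graph f \<longleftrightarrow>
      poly f (A$1$1 * y + A$1$2 * poly f y) = A$2$1 * y + A$2$2 * poly f y" for y
    by (auto simp: graph_def vec_eq_iff forall_2 matrix_vector_mult_def sum_2)
  moreover have "A \<in> stabilizer f \<longleftrightarrow> (\<forall>y. A *v vector [y, poly f y] \<in> graph f)"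
    unfolding stabilizer_def by (auto simp: graph_def)
  ultimately show ?thesis
    by simp
qed

definition code_comb :: "'a::finite_field poly \<Rightarrow> 'a \<Rightarrow> 'a \<Rightarrow> 'a poly" where
  "code_comb f a b = Polynomial.smult a (monom 1 1) + Polynomial.smult b f"

lemma poly_code_comb [simp]: "poly (code_comb f a b) y = a * y + b * poly f y"
  by (simp add: code_comb_def poly_monom)

lemma code_comb_in_qpolys:
  assumes "f \<in> qpolys q n" "n > 0"
  shows "code_comb f a b \<in> qpolys q n"
  unfolding code_comb_def using assms by (intro qpolys_add qpolys_smult X_in_qpolys)

lemma code_eq: "code f = {code_comb f a b | a b. True}"
  by (simp add: code_def code_comb_def)

text \<open>If \<open>b\<close> and \<open>b'\<close> differed, dividing by \<open>b - b'\<close>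
  would make \<open>f\<close> a scalar multiple of the identity.\<close>

lemma code_comb_eq_iff:
  assumes "f \<notin> span_x"
  shows "code_comb f a b = code_comb f a' b' \<longleftrightarrow> a = a' \<and> b = b'"
proof
  assume eq: "code_comb f a b = code_comb f a' b'"
  then have *: "Polynomial.smult (b - b') f = Polynomial.smult (a' - a) (monom 1 1)"
    by (simp add: code_comb_def smult_diff_left algebra_simps)
  have "b = b'"
  proof (rule ccontr)
    assume "b \<noteq> b'"
    then have "f = Polynomial.smult (1 / (b - b')) (Polynomial.smult (b - b') f)"
      by simp
    also have "\<dots> = Polynomial.smult ((a' - a) / (b - b')) (monom 1 1)"
      unfolding * by simp
    finally show False
      using assms by (auto simp: span_x_def)
  qed
  then show "a = a' \<and> b = b'"
    using * by simp
qed simp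

theorem theorem4p1:
  fixes q n :: nat and f :: "'a::finite_field poly"
  assumes "primepow q" and "n > 0" and "CARD('a) = q ^ n"
    and "f \<in> qpolys q n" and "f \<notin> span_x"
  shows "algebra_isomorphic (Fq q :: 'a set)
           (stabilizer_algebra f) (right_idealizer_algebra q n (code f))"
proof -
  note card = assms(3)
  have q: "2 \<le> q"
    using primepow_gt_Suc_0[OF assms(1)] by simp
  have deg: "degree (code_comb f a b) < CARD('a)" for a b
    by (rule degree_qpolys_less[OF card q code_comb_in_qpolys[OF assms(4,2)]])
  have X: "monom 1 1 = code_comb f 1 0" and f: "f = code_comb f 0 1"
    by (simp_all add: code_comb_def)
  \<comment> \<open>Both sides have degree below the field size, so they agree once their values
    do.\<close>
  have qcomp_eq_iff: "qcomp q n h g = code_comb f c d \<longleftrightarrow>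
      (\<forall>y. poly h (poly g y) = c * y + d * poly f y)" for h g c d
    using poly_eq_if_eval_eq[OF degree_qcomp_less[OF card] deg]
    by (metis poly_qcomp[OF card] poly_code_comb)
  define \<phi> where "\<phi> = (\<lambda>A :: 'a^2^2. code_comb f (A$1$1) (A$1$2))"
  \<comment> \<open>The second row of a stabilizing matrix consists of the coordinates of
    \<open>f\<close> composed with \<open>\<phi> A\<close>.\<close>
  have stab: "A \<in> stabilizer f \<longleftrightarrow> qcomp q n f (\<phi> A) = code_comb f (A$2$1) (A$2$2)" for A
    by (simp add: qcomp_eq_iff mem_stabilizer_iff \<phi>_def)
  have "\<phi> A \<in> right_idealizer q n (code f)" if A: "A \<in> stabilizer f" for A
  proof -
    \<comment> \<open>Composition with \<open>\<phi> A\<close> acts on coordinates as right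
      multiplication of the row \<open>(a, b)\<close> by \<open>A\<close>.\<close>
    have "qcomp q n (code_comb f a b) (\<phi> A) =
        code_comb f (a * A$1$1 + b * A$2$1) (a * A$1$2 + b * A$2$2)" for a b
      using A by (simp add: qcomp_eq_iff mem_stabilizer_iff \<phi>_def algebra_simps)
    then show ?thesis
      using code_comb_in_qpolys[OF assms(4,2)]
      by (auto simp: right_idealizer_def code_eq \<phi>_def)
  qed
  moreover have "\<phi> (A ** B) = qcomp q n (\<phi> A) (\<phi> B)"
    if "A \<in> stabilizer f" "B \<in> stabilizer f" for A B
  proof -
    \<comment> \<open>The first row of \<open>A\<close>, multiplied on the right by
      \<open>B\<close>, is the first row of the product; hence the order of factors is
      preserved.\<close>
    have "qcomp q n (\<phi> A) (\<phi> B) = code_comb f ((A ** B)$1$1) ((A ** B)$1$2)"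
      using that by (simp add: qcomp_eq_iff mem_stabilizer_iff \<phi>_def matrix_matrix_mult_def
          sum_2 algebra_simps)
    then show ?thesis
      by (simp add: \<phi>_def)
  qed
  moreover have "\<phi> (A + B) = \<phi> A + \<phi> B" for A B
    by (simp add: \<phi>_def code_comb_def smult_add_left algebra_simps)
  moreover have "\<phi> (mat 1) = monom 1 1"
    by (simp add: \<phi>_def mat_def code_comb_def)
  moreover have "\<phi> (map_matrix ((*) c) A) = Polynomial.smult c (\<phi> A)" for c A
    by (simp add: \<phi>_def code_comb_def map_matrix_def smult_add_right)
  moreover have "bij_betw \<phi> (stabilizer f) (right_idealizer q n (code f))"
  proof (rule bij_betw_imageI)
    show "inj_on \<phi> (stabilizer f)"
    proof (rule inj_onI)
      fix A B assume "A \<in> stabilizer f" "B \<in> stabilizer f" "\<phi> A = \<phi> B"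
      \<comment> \<open>The first rows agree by independence of the identity and \<open>f\<close>;
        the second rows are then coordinates of the same composition.\<close>
      then show "A = B"
        using code_comb_eq_iff[OF assms(5)] stab[of A] stab[of B]
        by (auto simp: \<phi>_def vec_eq_iff forall_2)
    qed
    have "g \<in> \<phi> ` stabilizer f" if g: "g \<in> right_idealizer q n (code f)" for g
    proof -
      have closed: "qcomp q n h g \<in> code f" if "h \<in> code f" for h
        using g that by (simp add: right_idealizer_def)
      \<comment> \<open>Testing the idealizer condition on the two generators of the code yields the
        two rows of the preimage.\<close>
      have "monom 1 1 \<in> code f" "f \<in> code f"
        unfolding code_eq using X f by blast+
      then obtain a b c d where ab: "qcomp q n (monom 1 1) g = code_comb f a b"
        and cd: "qcomp q n f g = code_comb f c d"
        using closed unfolding code_eq by blast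
      have "g \<in> qpolys q n"
        using g by (simp add: right_idealizer_def)
      \<comment> \<open>Composing the identity with \<open>g\<close> gives back \<open>g\<close>, so
        \<open>g\<close> itself lies in the code.\<close>
      moreover have "poly g y = poly (code_comb f a b) y" for y
        using ab by (simp add: qcomp_eq_iff poly_monom)
      ultimately have g_eq: "g = code_comb f a b"
        by (intro poly_eq_if_eval_eq deg degree_qpolys_less[OF card q])
      define A :: "'a^2^2" where "A = vector [vector [a, b], vector [c, d]]"
      have "\<phi> A = g" and "A \<in> stabilizer f"
        using cd by (simp_all add: stab A_def \<phi>_def g_eq)
      then show ?thesis
        by blast
    qed
    with calculation(1) show "\<phi> ` stabilizer f = right_idealizer q n (code f)"
      by blast
  qed
  ultimately show ?thesis
    unfolding algebra_isomorphic_def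
    by (intro bexI[of _ \<phi>])
      (auto simp: ring_iso_def ring_hom_def stabilizer_algebra_def right_idealizer_algebra_def)
qed

end
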